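(* Let $m\ge2$ be an integer and $G$ a matrix over $\mathrm{GF}(2)$ of rank $r$ with column set $E$. For $k=0,\dots,2m+1$ let $\mathcal{T}_m(k,2m+2)$ be the set of $(m+1)$-tuples $(f_1,\dots,f_{m+1})$ of functions $f_j:E\to\mathrm{GF}(2)$ such that $f_j-f_{j+1}$ lies in the row space of $G$ over $\mathrm{GF}(2)$ for $j=1,\dots,m$, and $\sum_{j=1}^{m+1}|\mathrm{supp}(f_j)|\equiv k\pmod{2m+2}$. Then $$\sum_{k=0}^{2m+1}e^{k\pi i/(m+1)}|\mathcal{T}_m(k,2m+2)|\ne0 \quad\text{if and only if}\quad \chi(M(G);2^m)\ne0.$$
   Context: $i=\sqrt{-1}$; $\mathrm{supp}(f)=\{e: f(e)\ne0\}$. $M(G)$ is the matroid on $E$ of linear dependence of the columns of $G$, with rank function $\mathrm{rk}$ and rank $r$; $\chi(M;\lambda)=\sum_{B\subseteq E}(-1)^{|B|}\lambda^{r-\mathrm{rk}(B)}$ is its characteristic polynomial. *)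

theory Defs
  imports
    Complex_Main
    "HOL-Library.FuncSet"
    "HOL-Library.Z2"
    "HOL-Computational_Algebra.Polynomial"
    "HOL-Number_Theory.Cong"
    "Jordan_Normal_Form.DL_Rank"
begin

locale matroid =
  fixes E :: "'e set" and indep :: "'e set \<Rightarrow> bool"
  assumes finite_ground: "finite E"
    and indep_subset_ground: "indep I \<Longrightarrow> I \<subseteq> E"
    and indep_empty: "indep {}"
    and indep_mono: "indep J \<Longrightarrow> I \<subseteq> J \<Longrightarrow> indep I"
    and augment: "indep I \<Longrightarrow> indep J \<Longrightarrow> card I < card J \<Longrightarrow> \<exists>x\<in>J - I. indep (insert x I)"
begin

definition rk :: "'e set \<Rightarrow> nat" where
  "rk B = Max (card ` {I. I \<subseteq> B \<and> indep I})"

definition characteristic_poly :: "int poly" where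
  "characteristic_poly = (\<Sum>B\<in>Pow E. monom ((-1) ^ card B) (rk E - rk B))"

text \<open>The exponent is a subtraction of naturals, but it never truncates.\<close>

lemma rk_mono:
  assumes "A \<subseteq> B" "B \<subseteq> E"
  shows "rk A \<le> rk B"
proof -
  have "finite {I. I \<subseteq> B \<and> indep I}"
    using assms finite_subset[OF _ finite_ground] by simp
  moreover have "{I. I \<subseteq> A \<and> indep I} \<noteq> {}"
    using indep_empty by blast
  ultimately show ?thesis
    unfolding rk_def using assms(1) by (intro Max_mono) auto
qed

end

text \<open>Columns are identified with their indices. Injectivity of \<^term>\<open>col G\<close> makes
  equal columns at distinct indices dependent, since \<open>lin_indpt\<close> is a predicate on sets
  of vectors.\<close>

definition (in vec_space) cols_indep :: "'a mat \<Rightarrow> nat set \<Rightarrow> bool" where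
  "cols_indep G B \<longleftrightarrow> B \<subseteq> {..<dim_col G} \<and> inj_on (col G) B \<and> lin_indpt (col G ` B)"

lemma (in vec_space) matroid_cols_indep:
  assumes G: "G \<in> carrier_mat n nc"
  shows "matroid {..<nc} (cols_indep G)"
proof
  have dc: "dim_col G = nc" using G by simp
  have car: "col G ` B \<subseteq> carrier_vec n" for B using G by auto
  show "finite {..<nc}" by simp
  show "I \<subseteq> {..<nc}" if "cols_indep G I" for I
    using that dc by (simp add: cols_indep_def)
  show "cols_indep G {}"
    by (simp add: cols_indep_def lin_dep_def)
  show "cols_indep G I" if "cols_indep G J" "I \<subseteq> J" for I J
    using that unfolding cols_indep_def
    by (meson image_mono inj_on_subset order_trans subset_li_is_li)
  show "\<exists>x\<in>J - I. cols_indep G (insert x I)"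
    if I: "cols_indep G I" and J: "cols_indep G J" and less: "card I < card J" for I J
  proof (rule ccontr)
    assume no: "\<not> ?thesis"
    have fin: "finite I" "finite J"
      using I J finite_subset[of _ "{..<dim_col G}"] by (auto simp: cols_indep_def)
    have "col G x \<in> span (col G ` I)" if x: "x \<in> J" for x
    proof (cases "col G x \<in> col G ` I")
      case True
      then show ?thesis using span_mem[OF car] by blast
    next
      case False
      then have "x \<notin> I" by blast
      then have "\<not> cols_indep G (insert x I)" using no x by blast
      moreover have "insert x I \<subseteq> {..<dim_col G}" "inj_on (col G) (insert x I)"
        using I J x False by (auto simp: cols_indep_def)
      ultimately have "lin_dep (col G ` I \<union> {col G x})"
        by (simp add: cols_indep_def)
      then show ?thesis
        using lin_dep_iff_in_span[of "col G ` I" "col G x"] I False car[of I] car[of "{x}"]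
        by (auto simp: cols_indep_def)
    qed
    then have "col G ` J \<subseteq> span (col G ` I)" by blast
    moreover have "lin_indpt (col G ` J)" using J by (simp add: cols_indep_def)
    ultimately obtain C where
      "int (card (C :: 'a vec set)) \<le> int (card (col G ` I)) - int (card (col G ` J))"
      using replacement[of "col G ` J" "col G ` I"] fin car[of I] by auto
    moreover have "card (col G ` I) = card I" "card (col G ` J) = card J"
      using I J by (auto simp: cols_indep_def card_image)
    ultimately show False using less by linarith
  qed
qed

text \<open>Sanity check: the rank of the matroid of \<open>G\<close> is the rank of \<open>G\<close>.\<close>

lemma (in vec_space) rk_ground_eq_rank:
  assumes G: "G \<in> carrier_mat n nc"
  shows "matroid.rk (cols_indep G) {..<nc} = rank G"
proof -
  interpret M: matroid "{..<nc}" "cols_indep G" using matroid_cols_indep[OF G] .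
  have dc: "dim_col G = nc" using G by simp
  have cols: "set (cols G) = col G ` {..<nc}" using dc by (auto simp: cols_def)
  let ?F = "{I. I \<subseteq> {..<nc} \<and> cols_indep G I}"
  have finF: "finite ?F" by simp
  have "?F \<noteq> {}" using M.indep_empty by blast
  with finF have "M.rk {..<nc} \<in> card ` ?F" unfolding M.rk_def by (intro Max_in) auto
  then obtain I where I: "cols_indep G I" "card I = M.rk {..<nc}" by auto
  have max: "card J \<le> card I" if "cols_indep G J" for J
    using that finF M.indep_subset_ground unfolding I(2) M.rk_def by (intro Max_ge) auto
  have "maximal (col G ` I) (\<lambda>T. T \<subseteq> set (cols G) \<and> lin_indpt T)"
    unfolding maximal_def
  proof (intro conjI allI impI)
    show "col G ` I \<subseteq> set (cols G)" "lin_indpt (col G ` I)"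
      using I(1) dc cols by (auto simp: cols_indep_def)
    fix T assume T: "col G ` I \<subseteq> T \<and> T \<subseteq> set (cols G) \<and> lin_indpt T"
    then obtain J where J: "J \<subseteq> {..<nc}" "inj_on (col G) J" "T = col G ` J"
      unfolding cols by (meson subset_image_inj)
    then have "cols_indep G J" using T dc by (simp add: cols_indep_def)
    then have "card T \<le> card (col G ` I)"
      using max J I(1) by (simp add: card_image cols_indep_def)
    then show "T = col G ` I"
      using T by (metis List.finite_set card_seteq finite_subset)
  qed
  then have "rank G = card (col G ` I)" by (rule rank_card_indpt[OF G])
  then show ?thesis using I by (simp add: card_image cols_indep_def)
qed

text \<open>Functions from the column set to the field are vectors of dimension \<^term>\<open>dim_col G\<close>.\<close>

definition supp_vec :: "'a::zero vec \<Rightarrow> nat set" where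
  "supp_vec f = {e. e < dim_vec f \<and> f $ e \<noteq> 0}"

definition weight_tuples :: "bit mat \<Rightarrow> nat \<Rightarrow> nat \<Rightarrow> nat \<Rightarrow> (nat \<Rightarrow> bit vec) set" where
  "weight_tuples G m k l =
    {f \<in> {1..m+1} \<rightarrow>\<^sub>E carrier_vec (dim_col G).
       (\<forall>j\<in>{1..m}. f j - f (j+1) \<in> vec_space.row_space (dim_col G) G) \<and>
       [(\<Sum>j=1..m+1. card (supp_vec (f j))) = k] (mod l)}"

end

theory Submission
  imports Defs
begin

text \<open>Let \<open>\<omega> = exp (\<pi>i/(m+1))\<close>; the sum is \<open>\<Sum> \<omega>^(total weight)\<close> over all tuples. A tuple is
  \<open>(c\<^sub>1 + v, \<dots>, c\<^sub>m + v, v)\<close> with codewords \<open>c\<^sub>j\<close> and \<open>v\<close> arbitrary, and for fixed \<open>c\<close> the sum over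
  \<open>v\<close> factors over the columns: a column lying in the supports of exactly \<open>w\<close> of the \<open>c\<^sub>j\<close> contributes
  \<open>\<omega>^w + \<omega>^(m+1-w) = 2i sin (\<pi>w/(m+1))\<close>. Up to the factor \<open>(2i)^n\<close> the sum thus consists of
  nonnegative terms, and it vanishes iff no \<open>m\<close>-tuple of codewords has supports covering all
  columns. By the critical theorem of Crapo and Rota the number of covering \<open>m\<close>-tuples is the
  value of the characteristic polynomial at \<open>2^m\<close>.\<close>

section \<open>Sums over binary vectors\<close>

lemma UNIV_bit: "(UNIV :: bit set) = {0, 1}"
  using bit_not_zero_iff by blast

text \<open>Distributivity: the coordinates of \<open>f\<close> range independently over the two
  field elements. This serves both the character sum over \<open>x\<close> below and the sum over
  the last entry \<open>v\<close> of a tuple.\<close>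

lemma sum_prod_carrier_vec:
  fixes g :: "nat \<Rightarrow> bit \<Rightarrow> 'c::comm_semiring_1"
  shows "(\<Sum>f\<in>carrier_vec n. \<Prod>e<n. g e (f $ e)) = (\<Prod>e<n. g e 0 + g e 1)"
proof -
  have "(\<Prod>e<n. g e 0 + g e 1) = (\<Prod>e<n. \<Sum>b\<in>UNIV. g e b)"
    by (simp add: UNIV_bit)
  also have "\<dots> = (\<Sum>f\<in>{..<n} \<rightarrow>\<^sub>E UNIV. \<Prod>e<n. g e (f e))"
    by (rule prod_sum_PiE) (auto simp: UNIV_bit)
  also have "\<dots> = (\<Sum>f\<in>carrier_vec n. \<Prod>e<n. g e (f $ e))"
    by (rule sum.reindex_bij_witness[of _ "\<lambda>f. restrict (vec_index f) {..<n}" "vec n"])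
       (auto intro!: ext prod.cong simp: PiE_def extensional_def)
  finally show ?thesis ..
qed

lemma finite_carrier_vec_bit: "finite (carrier_vec n :: bit vec set)"
proof -
  have "carrier_vec n \<subseteq> vec n ` ({..<n} \<rightarrow>\<^sub>E (UNIV :: bit set))"
  proof
    fix x :: "bit vec" assume "x \<in> carrier_vec n"
    then have "x = vec n (restrict (vec_index x) {..<n})" by auto
    then show "x \<in> vec n ` ({..<n} \<rightarrow>\<^sub>E UNIV)" by (rule image_eqI[where f = "vec n"]) simp
  qed
  moreover have "finite ({..<n} \<rightarrow>\<^sub>E (UNIV :: bit set))"
    by (intro finite_PiE) (auto simp: UNIV_bit)
  ultimately show ?thesis by (meson finite_imageI finite_subset)
qed

section \<open>Orthogonal complements of independent columns\<close>

text \<open>The nontrivial additive character of GF(2).\<close>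

definition bit_sign :: "bit \<Rightarrow> int" where
  "bit_sign b = (if b = 0 then 1 else - 1)"

lemma bit_sign_0 [simp]: "bit_sign 0 = 1" and bit_sign_1 [simp]: "bit_sign 1 = - 1"
  by (simp_all add: bit_sign_def)

lemma bit_sign_add: "bit_sign (a + b) = bit_sign a * bit_sign b"
  by (cases a; cases b) simp_all

lemma bit_sign_sum: "bit_sign (\<Sum>i\<in>A. f i) = (\<Prod>i\<in>A. bit_sign (f i))"
proof (induction A rule: infinite_finite_induct)
  case (insert x F)
  then show ?case by (metis bit_sign_add prod.insert sum.insert)
qed simp_all

text \<open>For \<open>B = {..<n}\<close> this is the kernel of the map \<open>encode\<close> below;
  for general \<open>B\<close> it is the preimage of the codewords vanishing on
  \<open>B\<close>.\<close>

definition annihilator :: "nat \<Rightarrow> bit mat \<Rightarrow> nat set \<Rightarrow> bit vec set" where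
  "annihilator d G B = {x \<in> carrier_vec d. \<forall>e\<in>B. col G e \<bullet> x = 0}"

text \<open>Over GF(2) a vanishing sum of columns is a linear relation with all coefficients 1.
  Injectivity of \<open>col G\<close> on \<open>I\<close> turns the sum over indices into one over
  vectors.\<close>

lemma sum_cols_eq_0_imp_empty:
  fixes G :: "bit mat"
  assumes G: "G \<in> carrier_mat d n" and I: "vec_space.cols_indep d G I"
    and zero: "\<And>i. i < d \<Longrightarrow> (\<Sum>e\<in>I. col G e $ i) = 0"
  shows "I = {}"
proof (rule ccontr)
  assume "I \<noteq> {}"
  interpret V: vec_space "TYPE(bit)" d .
  have I': "I \<subseteq> {..<n}" "inj_on (col G) I" "V.lin_indpt (col G ` I)"
    using I G by (auto simp: V.cols_indep_def)
  have car: "col G ` I \<subseteq> carrier_vec d" using G by auto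
  have "V.lincomb (\<lambda>_. 1) (col G ` I) = 0\<^sub>v d"
  proof (rule eq_vecI)
    show "dim_vec (V.lincomb (\<lambda>_. 1) (col G ` I)) = dim_vec (0\<^sub>v d :: bit vec)"
      using V.lincomb_dim[OF _ car] I'(1) finite_subset by fastforce
    show "V.lincomb (\<lambda>_. 1) (col G ` I) $ i = 0\<^sub>v d $ i" if "i < dim_vec (0\<^sub>v d :: bit vec)" for i
    proof -
      have i: "i < d" using that by simp
      have "V.lincomb (\<lambda>_. 1) (col G ` I) $ i = (\<Sum>v\<in>col G ` I. v $ i)"
        by (simp only: V.lincomb_index[OF i car] mult_1)
      also have "\<dots> = (\<Sum>e\<in>I. col G e $ i)" by (simp only: sum.reindex[OF I'(2)] o_def)
      finally show ?thesis using i zero by simp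
    qed
  qed
  moreover have "finite (col G ` I)" using I'(1) finite_subset by blast
  ultimately have "V.lin_dep (col G ` I)"
    unfolding V.lin_dep_def using \<open>I \<noteq> {}\<close>
    by (intro exI[of _ "col G ` I"] exI[of _ "\<lambda>_. 1"]) auto
  with I'(3) show False by simp
qed

text \<open>A character sum: expanding \<open>\<Prod>e\<in>I. 1 + (-1)\<^sup>\<langle>col e, x\<rangle>\<close> and summing over \<open>x\<close>, only the
  empty subset of \<open>I\<close> contributes.\<close>

lemma card_annihilator_indep:
  assumes G: "G \<in> carrier_mat d n" and I: "vec_space.cols_indep d G I"
  shows "2 ^ card I * card (annihilator d G I) = 2 ^ d"
proof -
  interpret V: vec_space "TYPE(bit)" d .
  have fin: "finite I" using I finite_subset by (auto simp: V.cols_indep_def)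
  let ?X = "carrier_vec d :: bit vec set"
  have indicator: "(\<Prod>e\<in>I. 1 + bit_sign (col G e \<bullet> x))
      = (if \<forall>e\<in>I. col G e \<bullet> x = 0 then 2 ^ card I else 0)" for x
  proof (cases "\<forall>e\<in>I. col G e \<bullet> x = 0")
    case True
    then have "(\<Prod>e\<in>I. 1 + bit_sign (col G e \<bullet> x)) = (\<Prod>e\<in>I. 2)" by (intro prod.cong) auto
    with True show ?thesis by simp
  next
    case False
    then obtain e where "e \<in> I" "col G e \<bullet> x = 1" by auto
    then have "(\<Prod>e\<in>I. 1 + bit_sign (col G e \<bullet> x)) = 0" using fin by (intro prod_zero bexI[of _ e]) auto
    with False show ?thesis by simp
  qed
  \<comment> \<open>Orthogonality of characters: the product is the character of \<open>x\<close>
    attached to the sum of the columns in \<open>T\<close>. By independence this sum is nonzero for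
    nonempty \<open>T\<close>, and a nontrivial character sums to 0.\<close>
  have orth: "(\<Sum>x\<in>?X. \<Prod>e\<in>T. bit_sign (col G e \<bullet> x)) = (if T = {} then 2 ^ d else 0)"
    if T: "T \<subseteq> I" for T
  proof -
    let ?s = "\<lambda>i. \<Sum>e\<in>T. col G e $ i"
    have "(\<Prod>e\<in>T. bit_sign (col G e \<bullet> x)) = (\<Prod>i<d. bit_sign (?s i * x $ i))" if "x \<in> ?X" for x
    proof -
      have "(\<Sum>e\<in>T. col G e \<bullet> x) = (\<Sum>e\<in>T. \<Sum>i<d. col G e $ i * x $ i)"
        using that by (simp only: scalar_prod_def carrier_vecD atLeast0LessThan)
      also have "\<dots> = (\<Sum>i<d. ?s i * x $ i)"
        by (subst sum.swap) (simp only: sum_distrib_right)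
      finally show ?thesis by (simp only: bit_sign_sum[symmetric])
    qed
    then have "(\<Sum>x\<in>?X. \<Prod>e\<in>T. bit_sign (col G e \<bullet> x))
        = (\<Sum>x\<in>?X. \<Prod>i<d. bit_sign (?s i * x $ i))" by simp
    also have "\<dots> = (\<Prod>i<d. 1 + bit_sign (?s i))"
      by (subst sum_prod_carrier_vec[where g = "\<lambda>i b. bit_sign (?s i * b)"])
        (simp only: mult_zero_right mult_1_right bit_sign_0)
    also have "\<dots> = (if T = {} then 2 ^ d else 0)"
    proof (cases "T = {}")
      case True
      then show ?thesis by simp
    next
      case False
      have "V.cols_indep G T" using V.matroid_cols_indep[OF G] I T by (blast intro: matroid.indep_mono)
      then obtain i where "i < d" "?s i \<noteq> 0"
        using sum_cols_eq_0_imp_empty[OF G, of T] False by blast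
      then show ?thesis using False by (auto intro!: prod_zero bexI[of _ i])
    qed
    finally show ?thesis .
  qed
  \<comment> \<open>The product is \<open>2 ^ card I\<close> on the annihilator and 0 elsewhere, so
    its sum counts the annihilator.\<close>
  have "int (2 ^ card I * card (annihilator d G I)) = (\<Sum>x\<in>?X. \<Prod>e\<in>I. 1 + bit_sign (col G e \<bullet> x))"
    unfolding indicator annihilator_def
    by (simp add: sum.If_cases finite_carrier_vec_bit Int_def mult.commute)
  also have "\<dots> = (\<Sum>x\<in>?X. \<Sum>T\<in>Pow I. \<Prod>e\<in>T. bit_sign (col G e \<bullet> x))"
    by (simp add: prod_add[OF fin] add.commute[of 1])
  also have "\<dots> = (\<Sum>T\<in>Pow I. \<Sum>x\<in>?X. \<Prod>e\<in>T. bit_sign (col G e \<bullet> x))"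
    by (rule sum.swap)
  also have "\<dots> = (\<Sum>T\<in>Pow I. if T = {} then 2 ^ d else 0)"
    using orth by (intro sum.cong) auto
  also have "\<dots> = int (2 ^ d)" using fin by simp
  finally show ?thesis by (simp only: of_nat_eq_iff)
qed

section \<open>From independent sets to arbitrary sets of columns\<close>

lemma (in matroid) rk_basis:
  assumes "B \<subseteq> E"
  obtains I where "I \<subseteq> B" "indep I" "card I = rk B" "\<forall>e\<in>B - I. \<not> indep (insert e I)"
proof -
  let ?F = "{I. I \<subseteq> B \<and> indep I}"
  have finB: "finite B" using assms finite_ground finite_subset by blast
  then have finF: "finite ?F" by simp
  have "?F \<noteq> {}" using indep_empty by blast
  with finF have "rk B \<in> card ` ?F" unfolding rk_def by (intro Max_in) auto
  then obtain I where I: "I \<subseteq> B" "indep I" "card I = rk B" by auto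
  show thesis
  proof (rule that[OF I], rule ballI)
    fix e assume e: "e \<in> B - I"
    show "\<not> indep (insert e I)"
    proof
      assume "indep (insert e I)"
      \<comment> \<open>An independent extension of \<open>I\<close> inside \<open>B\<close> would
        be too large for the maximum defining \<open>rk B\<close>.\<close>
      then have "card (insert e I) \<le> rk B"
        unfolding rk_def using finF e I(1) by (intro Max_ge) auto
      then show False using e I finite_subset[OF I(1) finB] by simp
    qed
  qed
qed

text \<open>By maximality every column in \<open>B\<close> lies in the span of the columns in
  \<open>I\<close>, and orthogonality to a set extends to its span.\<close>

lemma annihilator_basis:
  fixes G :: "bit mat"
  assumes G: "G \<in> carrier_mat d n" and B: "B \<subseteq> {..<n}"
    and I: "I \<subseteq> B" "vec_space.cols_indep d G I"
    and max: "\<forall>e\<in>B - I. \<not> vec_space.cols_indep d G (insert e I)"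
  shows "annihilator d G B = annihilator d G I"
proof
  interpret V: vec_space "TYPE(bit)" d .
  show "annihilator d G B \<subseteq> annihilator d G I" using I(1) by (auto simp: annihilator_def)
  show "annihilator d G I \<subseteq> annihilator d G B"
  proof
    fix x assume x: "x \<in> annihilator d G I"
    have car: "col G ` I \<subseteq> carrier_vec d" using G by auto
    have "col G e \<bullet> x = 0" if e: "e \<in> B" for e
    proof (cases "col G e \<in> col G ` I")
      \<comment> \<open>This covers equal columns at distinct indices as well;
        \<open>lin_dep_iff_in_span\<close> applies only to a vector outside the set.\<close>
      case True
      then show ?thesis using x by (auto simp: annihilator_def)
    next
      case False
      then have "e \<notin> I" by blast
      then have "\<not> V.cols_indep G (insert e I)" using max e by blast
      moreover have "insert e I \<subseteq> {..<dim_col G}" "inj_on (col G) (insert e I)"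
        using I B e G False by (auto simp: V.cols_indep_def)
      ultimately have "V.lin_dep (col G ` I \<union> {col G e})"
        by (simp add: V.cols_indep_def)
      then have "col G e \<in> V.span (col G ` I)"
        using V.lin_dep_iff_in_span[OF car, of "col G e"] I(2) False G
        by (auto simp: V.cols_indep_def)
      moreover have "x \<in> V.orthogonal_complement (V.span (col G ` I))"
        unfolding V.in_orthogonal_complement_span[OF car]
        using x G car
        by (auto simp: annihilator_def V.orthogonal_complement_def comm_scalar_prod[of x d])
      ultimately have "x \<bullet> col G e = 0"
        unfolding V.orthogonal_complement_def by blast
      moreover have "col G e \<in> carrier_vec d" "x \<in> carrier_vec d"
        using x G by (auto simp: annihilator_def)
      ultimately show ?thesis by (metis comm_scalar_prod)
    qed
    then show "x \<in> annihilator d G B" using x by (simp add: annihilator_def)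
  qed
qed

text \<open>Rank-nullity in counted form, obtained from a basis of \<open>B\<close>. Stating it as a
  product avoids the natural subtraction \<open>d - rk B\<close>.\<close>

lemma card_annihilator:
  assumes G: "G \<in> carrier_mat d n" and B: "B \<subseteq> {..<n}"
  shows "2 ^ matroid.rk (vec_space.cols_indep d G) B * card (annihilator d G B) = 2 ^ d"
proof -
  interpret V: vec_space "TYPE(bit)" d .
  interpret M: matroid "{..<n}" "V.cols_indep G" using V.matroid_cols_indep[OF G] .
  obtain I where I: "I \<subseteq> B" "V.cols_indep G I" "card I = M.rk B"
    "\<forall>e\<in>B - I. \<not> V.cols_indep G (insert e I)"
    using M.rk_basis[OF B] by blast
  then show ?thesis
    using card_annihilator_indep[OF G I(2)] annihilator_basis[OF G B I(1,2,4)] by simp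
qed


section \<open>The critical theorem\<close>

abbreviation code :: "bit mat \<Rightarrow> bit vec set" where
  "code G \<equiv> vec_space.row_space (dim_col G) G"

text \<open>Multiplication by the transpose of \<open>G\<close>, written by coordinates so that
  vanishing at \<open>e\<close> is literally a condition of \<open>annihilator\<close>.\<close>

definition encode :: "bit mat \<Rightarrow> bit vec \<Rightarrow> bit vec" where
  "encode G x = vec (dim_col G) (\<lambda>e. col G e \<bullet> x)"

lemma code_eq_encode:
  assumes G: "G \<in> carrier_mat d n"
  shows "code G = encode G ` carrier_vec d"
proof -
  \<comment> \<open>The row space lives in dimension \<open>n\<close>, whereas the matroid of
    columns uses dimension \<open>d\<close>.\<close>
  interpret V: vec_space "TYPE(bit)" n .
  have "transpose_mat G *\<^sub>v x = encode G x" for x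
    by (auto simp: encode_def)
  then show ?thesis using G V.row_space_eq[OF G] by (auto simp: encode_def)
qed

lemma finite_code: "finite (code G)"
  using code_eq_encode[of G "dim_row G" "dim_col G"] finite_carrier_vec_bit by auto

lemma code_carrier: "c \<in> code G \<Longrightarrow> c \<in> carrier_vec (dim_col G)"
  using code_eq_encode[of G "dim_row G" "dim_col G"] by (auto simp: encode_def)

lemma encode_add:
  assumes "x \<in> carrier_vec (dim_row G)" "y \<in> carrier_vec (dim_row G)"
  shows "encode G (x + y) = encode G x + encode G y"
proof (rule eq_vecI)
  fix e assume "e < dim_vec (encode G x + encode G y)"
  then have "e < dim_col G" by (simp add: encode_def)
  then show "encode G (x + y) $ e = (encode G x + encode G y) $ e"
    using scalar_prod_add_distrib[of "col G e" "dim_row G" x y] assms by (simp add: encode_def)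
qed (simp add: encode_def)

lemma code_add:
  assumes "a \<in> code G" "b \<in> code G"
  shows "a + b \<in> code G"
proof -
  note eq = code_eq_encode[of G "dim_row G" "dim_col G", simplified]
  obtain x y where "x \<in> carrier_vec (dim_row G)" "y \<in> carrier_vec (dim_row G)"
    "a = encode G x" "b = encode G y"
    using assms eq by auto
  then show ?thesis unfolding eq by (metis add_carrier_vec encode_add imageI)
qed

text \<open>In characteristic 2 translation by \<open>y\<close> is its own inverse.\<close>

lemma bit_vec_add_cancel: "y \<in> carrier_vec n \<Longrightarrow> x \<in> carrier_vec n \<Longrightarrow> y + (y + x) = x"
  for x y :: "bit vec"
proof (rule eq_vecI)
  fix i assume "y \<in> carrier_vec n" "x \<in> carrier_vec n" "i < dim_vec x"
  moreover have "a + (a + b) = b" for a b :: bit by (cases a; cases b) simp_all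
  ultimately show "(y + (y + x)) $ i = x $ i" by simp
qed simp

text \<open>\<open>encode\<close> maps the annihilator of \<open>B\<close> onto these codewords, and
  each fibre is a coset of the kernel \<open>?K\<close>. The count is thus a quotient of two
  annihilator sizes.\<close>

lemma card_code_vanishing:
  assumes G: "G \<in> carrier_mat d n" and B: "B \<subseteq> {..<n}"
  shows "card {c \<in> code G. \<forall>e\<in>B. c $ e = 0}
    = 2 ^ (matroid.rk (vec_space.cols_indep d G) {..<n} - matroid.rk (vec_space.cols_indep d G) B)"
proof -
  interpret V: vec_space "TYPE(bit)" d .
  interpret M: matroid "{..<n}" "V.cols_indep G" using V.matroid_cols_indep[OF G] .
  let ?C = "{c \<in> code G. \<forall>e\<in>B. c $ e = 0}" and ?K = "annihilator d G {..<n}"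
  have dim: "dim_col G = n" "dim_row G = d" using G by auto
  have fin: "finite (annihilator d G A)" for A
    unfolding annihilator_def using finite_carrier_vec_bit by simp
  have fib: "card {x \<in> annihilator d G B. encode G x = c} = card ?K" if c: "c \<in> ?C" for c
  proof -
    obtain y where y: "y \<in> carrier_vec d" "c = encode G y" using c code_eq_encode[OF G] by auto
    have yB: "col G e \<bullet> y = 0" if "e \<in> B" for e
    proof -
      have "encode G y $ e = 0" using c y that by simp
      then show ?thesis using that B dim by (auto simp: encode_def)
    qed
    have enc: "encode G x = encode G y \<longleftrightarrow> (\<forall>e<n. col G e \<bullet> x = col G e \<bullet> y)" for x
      by (auto simp: encode_def dim vec_eq_iff)
    have colG: "col G e \<in> carrier_vec d" for e using G by auto
    \<comment> \<open>Translation by the preimage \<open>y\<close> exchanges the fibre over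
      \<open>c\<close> with the kernel.\<close>
    show ?thesis
      by (rule bij_betw_same_card[of "\<lambda>x. y + x"], rule bij_betw_byWitness[of _ "\<lambda>x. y + x"])
        (use y yB B in \<open>auto simp: annihilator_def enc bit_vec_add_cancel
           scalar_prod_add_distrib[OF colG]\<close>)
  qed
  have "encode G ` annihilator d G B \<subseteq> ?C"
    using B dim code_eq_encode[OF G] by (auto simp: annihilator_def encode_def)
  then have "(\<Sum>c\<in>?C. card {x \<in> annihilator d G B. encode G x = c}) = card (annihilator d G B)"
    using sum.group[of "annihilator d G B" ?C "encode G" "\<lambda>_. 1 :: nat"] fin finite_code by simp
  then have "card ?C * card ?K = card (annihilator d G B)" using fib by simp
  moreover have "card ?C * 2 ^ M.rk B * card ?K = 2 ^ M.rk B * (card ?C * card ?K)" by simp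
  ultimately have "card ?C * 2 ^ M.rk B * card ?K = 2 ^ d"
    using card_annihilator[OF G B] by metis
  moreover have "2 ^ M.rk {..<n} * card ?K = 2 ^ d" using card_annihilator[OF G] by simp
  moreover have "(2::nat) ^ M.rk {..<n} = 2 ^ (M.rk {..<n} - M.rk B) * 2 ^ M.rk B"
    using M.rk_mono[OF B] by (simp flip: power_add)
  \<comment> \<open>\<open>card ?K\<close> may be cancelled: it divides \<open>2 ^ d\<close>, hence
    is nonzero.\<close>
  ultimately have "(card ?C * 2 ^ M.rk B) * card ?K
      = (2 ^ (M.rk {..<n} - M.rk B) * 2 ^ M.rk B) * card ?K \<and> card ?K \<noteq> 0"
    by (metis mult_0_right power_not_zero zero_neq_numeral)
  then show ?thesis by auto
qed

text \<open>Inclusion-exclusion over the sets \<open>B\<close> of columns on which all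
  \<open>m\<close> codewords vanish; each \<open>B\<close> contributes an \<open>m\<close>-th power
  of the count in \<open>card_code_vanishing\<close>, which is a power of
  \<open>2 ^ m\<close>.\<close>

lemma critical_theorem_binary:
  assumes G: "G \<in> carrier_mat d n"
  shows "int (card {c \<in> {1..m} \<rightarrow>\<^sub>E code G. \<forall>e<n. \<exists>j\<in>{1..m}. c j $ e \<noteq> 0})
    = poly (matroid.characteristic_poly {..<n} (vec_space.cols_indep d G)) (2 ^ m)"
proof -
  interpret V: vec_space "TYPE(bit)" d .
  interpret M: matroid "{..<n}" "V.cols_indep G" using V.matroid_cols_indep[OF G] .
  let ?Z = "{1..m} \<rightarrow>\<^sub>E code G"
  let ?van = "\<lambda>c e. \<forall>j\<in>{1..m}. c j $ e = (0::bit)"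
  have finZ: "finite ?Z" by (intro finite_PiE) (auto simp: finite_code)
  have prod_of_bool: "(\<Prod>e\<in>B. of_bool (P e)) = (of_bool (\<forall>e\<in>B. P e) :: int)"
    if "finite B" for B :: "nat set" and P
    using that by induction auto
  have "{c \<in> ?Z. \<forall>e<n. \<exists>j\<in>{1..m}. c j $ e \<noteq> 0} = {c \<in> ?Z. \<forall>e\<in>{..<n}. \<not> ?van c e}"
    by auto
  then have "int (card {c \<in> ?Z. \<forall>e<n. \<exists>j\<in>{1..m}. c j $ e \<noteq> 0})
      = (\<Sum>c\<in>?Z. of_bool (\<forall>e\<in>{..<n}. \<not> ?van c e))"
    using finZ by (simp add: sum_of_bool_eq Int_def)
  also have "\<dots> = (\<Sum>c\<in>?Z. \<Prod>e<n. of_bool (\<not> ?van c e))"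
    by (subst prod_of_bool) auto
  also have "\<dots> = (\<Sum>c\<in>?Z. \<Prod>e<n. 1 - of_bool (?van c e))"
    by (simp only: of_bool_not_iff)
  also have "\<dots> = (\<Sum>c\<in>?Z. \<Sum>B\<in>Pow {..<n}. (-1) ^ card B * of_bool (\<forall>e\<in>B. ?van c e))"
    by (subst prod_diff_conv_sum) (auto intro!: sum.cong simp: prod_of_bool finite_subset)
  also have "\<dots> = (\<Sum>B\<in>Pow {..<n}. (-1) ^ card B * (\<Sum>c\<in>?Z. of_bool (\<forall>e\<in>B. ?van c e)))"
    by (subst sum.swap) (simp add: sum_distrib_left)
  also have "\<dots> = (\<Sum>B\<in>Pow {..<n}. (-1) ^ card B * (2 ^ m) ^ (M.rk {..<n} - M.rk B))"
  proof (rule sum.cong)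
    fix B assume B: "B \<in> Pow {..<n}"
    \<comment> \<open>The entries of a tuple vanish on \<open>B\<close> independently of each other,
      so these tuples form a full function space.\<close>
    have "{c \<in> ?Z. \<forall>e\<in>B. ?van c e} = {1..m} \<rightarrow>\<^sub>E {c \<in> code G. \<forall>e\<in>B. c $ e = 0}"
      by (auto simp: PiE_iff extensional_def)
    then have "card {c \<in> ?Z. \<forall>e\<in>B. ?van c e} = (2 ^ (M.rk {..<n} - M.rk B)) ^ m"
      using card_code_vanishing[OF G, of B] B by (simp add: card_PiE)
    then have "(\<Sum>c\<in>?Z. of_bool (\<forall>e\<in>B. ?van c e)) = (2 ^ m :: int) ^ (M.rk {..<n} - M.rk B)"
      using finZ by (simp add: sum_of_bool_eq Int_def mult.commute flip: power_mult)
    then show "(-1) ^ card B * (\<Sum>c\<in>?Z. of_bool (\<forall>e\<in>B. ?van c e))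
        = (-1) ^ card B * (2 ^ m :: int) ^ (M.rk {..<n} - M.rk B)" by simp
  qed simp
  also have "\<dots> = poly M.characteristic_poly (2 ^ m)"
    by (simp add: M.characteristic_poly_def poly_sum poly_monom)
  finally show ?thesis .
qed


section \<open>The weighted sum over tuples\<close>

text \<open>The tuples of \<open>weight_tuples\<close> without the weight congruence, to be sorted
  by weight later.\<close>

abbreviation chain_tuples :: "bit mat \<Rightarrow> nat \<Rightarrow> (nat \<Rightarrow> bit vec) set" where
  "chain_tuples G m \<equiv> {f \<in> {1..m+1} \<rightarrow>\<^sub>E carrier_vec (dim_col G).
     \<forall>j\<in>{1..m}. f j - f (j+1) \<in> code G}"

lemma bit_vec_minus_eq_add: "x - y = x + y" for x y :: "bit vec"
  by (rule eq_vecI) auto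

lemma zero_in_code: "0\<^sub>v (dim_col G) \<in> code G"
proof -
  have "0\<^sub>v (dim_col G) = encode G (0\<^sub>v (dim_row G))"
    by (auto simp: encode_def)
  then show ?thesis
    using code_eq_encode[of G "dim_row G" "dim_col G"] by simp
qed

text \<open>The consecutive differences telescope, and the code is closed under addition; the
  induction descends from \<open>j = m + 1\<close>, where the sum is the zero vector.\<close>

lemma chain_tuple_diff_last:
  assumes f: "f \<in> chain_tuples G m" and j: "j \<le> m + 1" "1 \<le> j"
  shows "f j + f (m+1) \<in> code G"
  using j
proof (induction rule: inc_induct)
  case base
  have "f (m+1) \<in> carrier_vec (dim_col G)" using f by auto
  then have "f (m+1) + f (m+1) = 0\<^sub>v (dim_col G)" by auto
  then show ?case by (simp add: zero_in_code)
next
  case (step i)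
  then have i: "i \<in> {1..m}" by auto
  have car: "f i \<in> carrier_vec (dim_col G)" "f (i+1) \<in> carrier_vec (dim_col G)"
    "f (m+1) \<in> carrier_vec (dim_col G)"
    using f i by (auto simp: PiE_iff)
  have "f i - f (i+1) \<in> code G" using f i by auto
  moreover have "f (i+1) + f (m+1) \<in> code G" using step by simp
  ultimately have "(f i + f (i+1)) + (f (i+1) + f (m+1)) \<in> code G"
    using code_add by (simp add: bit_vec_minus_eq_add)
  moreover have "(f i + f (i+1)) + (f (i+1) + f (m+1)) = f i + f (m+1)"
    using car by (simp add: bit_vec_add_cancel)
  ultimately show ?case by simp
qed

text \<open>The coordinates are \<open>v\<close>, the last entry, and \<open>c j\<close>, the
  difference of entry \<open>j\<close> from it. The last index needs its own branch since
  \<open>c\<close> is only meaningful on \<open>{1..m}\<close>.\<close>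

lemma bij_betw_chain_tuples:
  "bij_betw (\<lambda>(c, v). \<lambda>j\<in>{1..m+1}. if j = m + 1 then v else c j + v)
     (({1..m} \<rightarrow>\<^sub>E code G) \<times> carrier_vec (dim_col G)) (chain_tuples G m)"
proof (rule bij_betw_byWitness[of _ "\<lambda>f. (\<lambda>j\<in>{1..m}. f j + f (m+1), f (m+1))"])
  let ?n = "dim_col G"
  have cancel: "x + v + v = x" "x + v + (y + v) = x + y"
    if "x \<in> carrier_vec ?n" "y \<in> carrier_vec ?n" "v \<in> carrier_vec ?n" for x y v :: "bit vec"
    using that by (auto intro!: eq_vecI simp: add.commute add.left_commute)
  show "\<forall>a\<in>({1..m} \<rightarrow>\<^sub>E code G) \<times> carrier_vec ?n.
      (\<lambda>f. (\<lambda>j\<in>{1..m}. f j + f (m+1), f (m+1)))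
        (case a of (c, v) \<Rightarrow> \<lambda>j\<in>{1..m+1}. if j = m + 1 then v else c j + v) = a"
    by (auto intro!: ext simp: cancel code_carrier PiE_iff extensional_def)
  show "\<forall>f\<in>chain_tuples G m.
      (case (\<lambda>j\<in>{1..m}. f j + f (m+1), f (m+1)) of
        (c, v) \<Rightarrow> \<lambda>j\<in>{1..m+1}. if j = m + 1 then v else c j + v) = f"
  proof
    fix f assume f: "f \<in> chain_tuples G m"
    have "f j + f (m+1) + f (m+1) = f j" if "j \<in> {1..m+1}" for j
      using f that by (intro cancel(1)) (auto simp: PiE_iff)
    then show "(case (\<lambda>j\<in>{1..m}. f j + f (m+1), f (m+1)) of
        (c, v) \<Rightarrow> \<lambda>j\<in>{1..m+1}. if j = m + 1 then v else c j + v) = f"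
      using f by (auto intro!: ext simp: PiE_iff extensional_def)
  qed
  show "(\<lambda>(c, v). \<lambda>j\<in>{1..m+1}. if j = m + 1 then v else c j + v)
      ` (({1..m} \<rightarrow>\<^sub>E code G) \<times> carrier_vec ?n) \<subseteq> chain_tuples G m"
  proof (rule image_subsetI)
    fix p :: "(nat \<Rightarrow> bit vec) \<times> bit vec" assume "p \<in> ({1..m} \<rightarrow>\<^sub>E code G) \<times> carrier_vec ?n"
    then obtain c and v :: "bit vec" where p: "p = (c, v)"
      and c: "c \<in> {1..m} \<rightarrow>\<^sub>E code G" and v: "v \<in> carrier_vec ?n" by auto
    let ?f = "\<lambda>j\<in>{1..m+1}. if j = m + 1 then v else c j + v"
    have cj: "c j \<in> code G" "c j \<in> carrier_vec ?n" if "j \<in> {1..m}" for j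
      using c that code_carrier by (auto simp: PiE_iff)
    have "?f j - ?f (j+1) \<in> code G" if j: "j \<in> {1..m}" for j
    proof (cases "j = m")
      case True
      then show ?thesis using j cj[OF j] v by (simp add: bit_vec_minus_eq_add cancel del: assoc_add_vec)
    next
      case False
      \<comment> \<open>Both entries carry the shift \<open>v\<close>, which cancels and leaves
        \<open>c j + c (j+1)\<close>.\<close>
      then have "j + 1 \<in> {1..m}" using j by auto
      then show ?thesis using j False cj[of j] cj[of "j+1"] v code_add[of "c j" G "c (j+1)"]
        by (simp add: bit_vec_minus_eq_add cancel del: assoc_add_vec)
    qed
    then have "?f \<in> chain_tuples G m" using cj v by auto
    then show "(case p of (c, v) \<Rightarrow> \<lambda>j\<in>{1..m+1}. if j = m + 1 then v else c j + v)
        \<in> chain_tuples G m" by (simp add: p)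
  qed
  show "(\<lambda>f. (\<lambda>j\<in>{1..m}. f j + f (m+1), f (m+1))) ` chain_tuples G m
      \<subseteq> ({1..m} \<rightarrow>\<^sub>E code G) \<times> carrier_vec ?n"
  proof (rule image_subsetI)
    fix f assume f: "f \<in> chain_tuples G m"
    then have "f (m+1) \<in> carrier_vec ?n" by auto
    moreover have "f j + f (m+1) \<in> code G" if "j \<in> {1..m}" for j
      using chain_tuple_diff_last[OF f] that by simp
    ultimately show "(\<lambda>j\<in>{1..m}. f j + f (m+1), f (m+1))
        \<in> ({1..m} \<rightarrow>\<^sub>E code G) \<times> carrier_vec ?n" by simp
  qed
qed

section \<open>Powers of the root of unity and their sine values\<close>

lemma card_filter_le: "card {j \<in> {1..m}. P j} \<le> m" for m :: nat
proof -
  have "card {j \<in> {1..m}. P j} \<le> card {1..m}" by (rule card_mono) auto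
  then show ?thesis by simp
qed

lemma power_card_eq_prod:
  "finite A \<Longrightarrow> x ^ card {a \<in> A. P a} = (\<Prod>a\<in>A. if P a then x else 1)"
  for x :: "'a::comm_monoid_mult"
  by (simp add: prod.If_cases Int_def)

text \<open>A primitive root of unity of order \<open>2*m+2\<close>, so its powers see exactly the
  weight modulo \<open>2*m+2\<close>.\<close>

definition root_of_unity :: "nat \<Rightarrow> complex" where
  "root_of_unity m = exp (complex_of_real pi * \<i> / of_nat (m+1))"

lemma root_of_unity_power: "root_of_unity m ^ k = cis (pi * k / (m+1))"
  by (simp add: root_of_unity_def cis_conv_exp flip: exp_of_nat_mult) (simp add: field_simps)

lemma sin_pi_fraction_pos:
  fixes w m :: nat
  assumes "0 < w" "w \<le> m"
  shows "0 < sin (pi * w / (m+1))"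
proof (rule sin_gt_zero)
  have "pi * w < pi * (m+1)" using assms by (intro mult_strict_left_mono) auto
  then show "pi * w / (m+1) < pi" by (simp add: pos_divide_less_eq)
qed (use assms in simp)

text \<open>The second summand is the reflection of the first in the imaginary axis: real parts
  cancel and imaginary parts double.\<close>

lemma sum_two_values:
  assumes "w \<le> m"
  shows "root_of_unity m ^ w + root_of_unity m * root_of_unity m ^ (m - w)
    = 2 * \<i> * complex_of_real (sin (pi * w / (m+1)))"
proof -
  have "root_of_unity m * root_of_unity m ^ (m - w) = root_of_unity m ^ (m + 1 - w)"
    using assms by (simp add: Suc_diff_le)
  also have "\<dots> = cis (pi - pi * w / (m+1))"
    using assms by (simp add: root_of_unity_power of_nat_diff field_simps)
  finally show ?thesis
    by (simp add: root_of_unity_power complex_eq_iff)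
qed

text \<open>Pulling \<open>2 * \<i>\<close> out of every column leaves a real sum, whose signs can
  then be examined.\<close>

lemma sum_chain_tuples:
  assumes n: "dim_col G = n"
  shows "(\<Sum>f\<in>chain_tuples G m. root_of_unity m ^ (\<Sum>j=1..m+1. card (supp_vec (f j))))
    = (2 * \<i>) ^ n * complex_of_real (\<Sum>c\<in>{1..m} \<rightarrow>\<^sub>E code G.
        \<Prod>e<n. sin (pi * card {j \<in> {1..m}. c j $ e \<noteq> 0} / (m+1)))"
proof -
  let ?\<omega> = "root_of_unity m" and ?Z = "{1..m} \<rightarrow>\<^sub>E code G"
  define h where "h b = (if b \<noteq> 0 then ?\<omega> else 1)" for b :: bit
  let ?F = "\<lambda>c v. \<lambda>j\<in>{1..m+1}. if j = m + 1 then v else c j + v"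
  have supp: "?\<omega> ^ card (supp_vec f) = (\<Prod>e<n. h (f $ e))" if "f \<in> carrier_vec n" for f
    using that power_card_eq_prod[of "{..<n}" ?\<omega> "\<lambda>e. f $ e \<noteq> 0"]
    by (simp add: supp_vec_def h_def)
  have term_eq: "?\<omega> ^ (\<Sum>j=1..m+1. card (supp_vec (?F c v j)))
      = (\<Prod>e<n. h (v $ e) * (\<Prod>j=1..m. h (c j $ e + v $ e)))"
    if c: "c \<in> ?Z" and v: "v \<in> carrier_vec n" for c v
  proof -
    have cj: "c j \<in> carrier_vec n" if "j \<in> {1..m}" for j
      using c that code_carrier n by (auto simp: PiE_iff)
    have "?\<omega> ^ (\<Sum>j=1..m+1. card (supp_vec (?F c v j)))
        = (\<Prod>j=1..m. ?\<omega> ^ card (supp_vec (c j + v))) * ?\<omega> ^ card (supp_vec v)"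
      by (simp add: power_sum power_add)
    also have "\<dots> = (\<Prod>j=1..m. \<Prod>e<n. h (c j $ e + v $ e)) * (\<Prod>e<n. h (v $ e))"
    proof -
      have "?\<omega> ^ card (supp_vec (c j + v)) = (\<Prod>e<n. h (c j $ e + v $ e))" if "j \<in> {1..m}" for j
        using cj[OF that] v by (subst supp) auto
      then show ?thesis using v by (simp add: supp)
    qed
    \<comment> \<open>Exchanging the products over entries and columns makes each factor depend on
      \<open>v\<close> only through \<open>v $ e\<close>.\<close>
    also have "\<dots> = (\<Prod>e<n. h (v $ e) * (\<Prod>j=1..m. h (c j $ e + v $ e)))"
      by (subst prod.swap) (simp add: prod.distrib mult.commute)
    finally show ?thesis .
  qed
  \<comment> \<open>The two summands are the choices 0 and 1 for \<open>v $ e\<close>. The choice 1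
    flips all \<open>m\<close> entries of the column, giving \<open>m - w\<close> nonzero ones, and
    adds one more from \<open>v\<close> itself.\<close>
  have factor: "h 0 * (\<Prod>j=1..m. h (c j $ e + 0)) + h 1 * (\<Prod>j=1..m. h (c j $ e + 1))
      = 2 * \<i> * complex_of_real (sin (pi * card {j \<in> {1..m}. c j $ e \<noteq> 0} / (m+1)))"
    for c :: "nat \<Rightarrow> bit vec" and e
  proof -
    let ?w = "card {j \<in> {1..m}. c j $ e \<noteq> 0}"
    have "{j \<in> {1..m}. c j $ e + 1 \<noteq> 0} = {1..m} - {j \<in> {1..m}. c j $ e \<noteq> 0}"
      by (auto simp del: bit_not_zero_iff)
    moreover have "card ({1..m} - {j \<in> {1..m}. c j $ e \<noteq> 0}) = m - ?w"
      by (subst card_Diff_subset) auto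
    ultimately have "card {j \<in> {1..m}. c j $ e + 1 \<noteq> 0} = m - ?w"
      by (simp only:)
    moreover have "?w \<le> m" by (rule card_filter_le)
    ultimately show ?thesis
      using sum_two_values[of ?w m] power_card_eq_prod[of "{1..m}" ?\<omega> "\<lambda>j. c j $ e \<noteq> 0"]
        power_card_eq_prod[of "{1..m}" ?\<omega> "\<lambda>j. c j $ e + 1 \<noteq> 0"]
      by (simp add: h_def)
  qed
  have "(\<Sum>f\<in>chain_tuples G m. ?\<omega> ^ (\<Sum>j=1..m+1. card (supp_vec (f j))))
      = (\<Sum>(c, v)\<in>?Z \<times> carrier_vec n. ?\<omega> ^ (\<Sum>j=1..m+1. card (supp_vec (?F c v j))))"
    using sum.reindex_bij_betw[OF bij_betw_chain_tuples[of m G],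
        of "\<lambda>f. ?\<omega> ^ (\<Sum>j=1..m+1. card (supp_vec (f j)))"]
    unfolding n by (simp only: case_prod_unfold)
  also have "\<dots> = (\<Sum>c\<in>?Z. \<Sum>v\<in>carrier_vec n. \<Prod>e<n. h (v $ e) * (\<Prod>j=1..m. h (c j $ e + v $ e)))"
    unfolding sum.cartesian_product[symmetric] by (intro sum.cong refl) (rule term_eq)
  also have "\<dots> = (\<Sum>c\<in>?Z. \<Prod>e<n. 2 * \<i> * complex_of_real (sin (pi * card {j \<in> {1..m}. c j $ e \<noteq> 0} / (m+1))))"
    by (subst sum_prod_carrier_vec[where g = "\<lambda>e b. h b * (\<Prod>j=1..m. h (_ j $ e + b))"])
      (simp only: factor)
  also have "\<dots> = (2 * \<i>) ^ n * complex_of_real (\<Sum>c\<in>?Z.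
        \<Prod>e<n. sin (pi * card {j \<in> {1..m}. c j $ e \<noteq> 0} / (m+1)))"
    by (simp add: prod.distrib sum_distrib_left)
  finally show ?thesis .
qed

text \<open>Sort the tuples by total weight modulo \<open>2*m+2\<close>; the power of the root is
  constant on each class.\<close>

lemma sum_weight_tuples:
  "(\<Sum>k=0..2*m+1. root_of_unity m ^ k * of_nat (card (weight_tuples G m k (2*m+2))))
    = (\<Sum>f\<in>chain_tuples G m. root_of_unity m ^ (\<Sum>j=1..m+1. card (supp_vec (f j))))"
proof -
  let ?\<omega> = "root_of_unity m" and ?U = "chain_tuples G m" and ?l = "2*m+2"
  let ?W = "\<lambda>f. \<Sum>j=1..m+1. card (supp_vec (f j :: bit vec))"
  have "?\<omega> ^ ?l = 1"
  proof -
    have "pi * real ?l / (m+1) = 2 * pi" by (simp add: field_simps)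
    then show ?thesis unfolding root_of_unity_power by simp
  qed
  then have mod: "?\<omega> ^ (k mod ?l) = ?\<omega> ^ k" for k
    by (metis div_mult_mod_eq mult.commute mult_1 power_add power_mult power_one)
  have fin: "finite ?U"
    by (rule finite_subset[of _ "{1..m+1} \<rightarrow>\<^sub>E carrier_vec (dim_col G)"])
      (auto intro!: finite_PiE finite_carrier_vec_bit)
  have "?\<omega> ^ k * of_nat (card (weight_tuples G m k ?l)) = (\<Sum>f | f \<in> ?U \<and> ?W f mod ?l = k. ?\<omega> ^ ?W f)"
    if "k \<in> {0..2*m+1}" for k
  proof -
    \<comment> \<open>In this range \<open>k\<close> is its own residue, so the congruence becomes
      an equation and the classes partition all tuples.\<close>
    have k: "k mod ?l = k" using that by (intro mod_less) auto
    have "weight_tuples G m k ?l = {f \<in> ?U. ?W f mod ?l = k}"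
      unfolding weight_tuples_def cong_def k by auto
    moreover have "(\<Sum>f | f \<in> ?U \<and> ?W f mod ?l = k. ?\<omega> ^ ?W f) = (\<Sum>f | f \<in> ?U \<and> ?W f mod ?l = k. ?\<omega> ^ k)"
      by (intro sum.cong refl) (metis (mono_tags, lifting) mem_Collect_eq mod)
    ultimately show ?thesis by (simp add: mult.commute)
  qed
  then have "(\<Sum>k=0..2*m+1. ?\<omega> ^ k * of_nat (card (weight_tuples G m k ?l)))
      = (\<Sum>k=0..2*m+1. \<Sum>f | f \<in> ?U \<and> ?W f mod ?l = k. ?\<omega> ^ ?W f)"
    by (rule sum.cong[OF refl])
  also have "\<dots> = (\<Sum>f\<in>?U. ?\<omega> ^ ?W f)"
    by (rule sum.group[OF fin]) (auto simp: less_Suc_eq_le[symmetric])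
  finally show ?thesis .
qed

section \<open>Nonvanishing of the sum and of the characteristic polynomial\<close>

theorem theorem5p6:
  fixes m d n r :: nat and G :: "bit mat"
  assumes "m \<ge> 2"
    and "G \<in> carrier_mat d n"
    and "vec_space.rank d G = r"
  shows "(\<Sum>k=0..2*m+1. exp (of_nat k * complex_of_real pi * \<i> / of_nat (m+1))
            * of_nat (card (weight_tuples G m k (2*m+2)))) \<noteq> 0
     \<longleftrightarrow> poly (matroid.characteristic_poly {..<n} (vec_space.cols_indep d G)) (2 ^ m) \<noteq> 0"
proof -
  let ?Z = "{1..m} \<rightarrow>\<^sub>E code G"
  let ?w = "\<lambda>c e. card {j \<in> {1..m}. c j $ e \<noteq> (0::bit)}"
  let ?p = "\<lambda>c. \<Prod>e<n. sin (pi * ?w c e / (m+1))"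
  have n: "dim_col G = n" using assms(2) by simp
  have finZ: "finite ?Z" by (intro finite_PiE) (auto simp: finite_code)
  have "exp (of_nat k * complex_of_real pi * \<i> / of_nat (m+1)) = root_of_unity m ^ k" for k
    by (simp add: root_of_unity_def mult.assoc flip: exp_of_nat_mult)
  then have "(\<Sum>k=0..2*m+1. exp (of_nat k * complex_of_real pi * \<i> / of_nat (m+1))
            * of_nat (card (weight_tuples G m k (2*m+2))))
      = (2 * \<i>) ^ n * complex_of_real (\<Sum>c\<in>?Z. ?p c)"
    using sum_weight_tuples[of m G] sum_chain_tuples[OF n, of m] by simp
  then have "(\<Sum>k=0..2*m+1. exp (of_nat k * complex_of_real pi * \<i> / of_nat (m+1))
            * of_nat (card (weight_tuples G m k (2*m+2)))) \<noteq> 0 \<longleftrightarrow> (\<Sum>c\<in>?Z. ?p c) \<noteq> 0"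
    by (simp del: of_real_sum)
  also have "\<dots> \<longleftrightarrow> (\<exists>c\<in>?Z. ?p c \<noteq> 0)"
  proof -
    have "0 \<le> sin (pi * ?w c e / (m+1))" for c e
    proof (cases "?w c e = 0")
      case True
      show ?thesis by (simp only: True of_nat_0 mult_zero_right div_0 sin_zero order_refl)
    next
      case False
      then show ?thesis
        by (intro less_imp_le[OF sin_pi_fraction_pos] card_filter_le) (simp only: neq0_conv)
    qed
    \<comment> \<open>With all terms nonnegative no cancellation can occur, so the sum is nonzero as
      soon as one term is.\<close>
    then have "0 \<le> ?p c" for c by (intro prod_nonneg)
    then show ?thesis using finZ by (subst sum_nonneg_eq_0_iff) auto
  qed
  also have "\<dots> \<longleftrightarrow> {c \<in> ?Z. \<forall>e<n. \<exists>j\<in>{1..m}. c j $ e \<noteq> 0} \<noteq> {}"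
  proof -
    \<comment> \<open>Since \<open>?w c e\<close> is at most \<open>m\<close>, the angle stays below
      \<open>pi\<close>, and the sine vanishes only for an uncovered column.\<close>
    have "sin (pi * ?w c e / (m+1)) \<noteq> 0 \<longleftrightarrow> (\<exists>j\<in>{1..m}. c j $ e \<noteq> 0)" for c e
    proof (cases "?w c e = 0")
      case True
      then have "{j \<in> {1..m}. c j $ e \<noteq> 0} = {}" by (subst (asm) card_0_eq) auto
      moreover have "sin (pi * ?w c e / (m+1)) = 0"
        by (simp only: True of_nat_0 mult_zero_right div_0 sin_zero)
      ultimately show ?thesis by blast
    next
      case False
      have "sin (pi * ?w c e / (m+1)) \<noteq> 0"
        using False
        by (intro less_imp_neq[THEN not_sym] sin_pi_fraction_pos card_filter_le)
          (simp only: neq0_conv)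
      moreover have "{j \<in> {1..m}. c j $ e \<noteq> 0} \<noteq> {}" using False by (metis card.empty)
      ultimately show ?thesis by blast
    qed
    then have "?p c \<noteq> 0 \<longleftrightarrow> (\<forall>e<n. \<exists>j\<in>{1..m}. c j $ e \<noteq> 0)" for c
      by (simp only: prod_zero_iff[OF finite_lessThan]) auto
    then show ?thesis by blast
  qed
  also have "\<dots> \<longleftrightarrow> int (card {c \<in> ?Z. \<forall>e<n. \<exists>j\<in>{1..m}. c j $ e \<noteq> 0}) \<noteq> 0"
    using finZ by (simp add: card_eq_0_iff)
  finally show ?thesis unfolding critical_theorem_binary[OF assms(2)] .
qed

end
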